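(* Products of quasisober spaces (respectively cut spaces, weakly sober spaces) are not always quasisober (respectively cut spaces, weakly sober). That is: (i) there is a family of quasisober spaces whose topological product is not quasisober; (ii) there is a family of cut spaces whose topological product is not a cut space; (iii) there is a family of weakly sober spaces whose topological product is not weakly sober.
   Context: For a topological space $X$, the specialization preorder is $x\le y$ iff $x\in\mathrm{cl}\{y\}$; all order-theoretic notions in $X$ refer to it. For $A\subseteq X$, $A^{\uparrow}$ and $A^{\downarrow}$ denote the sets of all upper, respectively lower, bounds of $A$ in $X$, and $A^{\delta}=(A^{\uparrow})^{\downarrow}$ is the cut closure of $A$; $A$ is a cut if $A=A^{\delta}$. Directed sets and irreducible closed sets are nonempty. $X$ is a cut space if $\mathrm{cl}\,D=D^{\delta}$ for every directed subset $D$ of $X$. $X$ is weakly sober if it is $T_0$ and every irreducible closed subset $A$ of $X$ is a cut. $X$ is quasisober if it is $T_0$ and every irreducible closed subset of $X$ equals $D^{\delta}$ for some directed subset $D$ of $X$. Products carry the product topology. *)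

theory Defs
  imports "HOL-Analysis.Analysis"
begin

definition spec_le :: "'a topology \<Rightarrow> 'a \<Rightarrow> 'a \<Rightarrow> bool" where
  "spec_le X x y \<longleftrightarrow> x \<in> topspace X \<and> y \<in> topspace X \<and> x \<in> X closure_of {y}"

definition upper_bounds_in :: "'a topology \<Rightarrow> 'a set \<Rightarrow> 'a set" where
  "upper_bounds_in X A = {u \<in> topspace X. \<forall>a\<in>A. spec_le X a u}"

definition lower_bounds_in :: "'a topology \<Rightarrow> 'a set \<Rightarrow> 'a set" where
  "lower_bounds_in X A = {l \<in> topspace X. \<forall>a\<in>A. spec_le X l a}"

definition cut_closure :: "'a topology \<Rightarrow> 'a set \<Rightarrow> 'a set" where
  "cut_closure X A = lower_bounds_in X (upper_bounds_in X A)"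

definition is_cut :: "'a topology \<Rightarrow> 'a set \<Rightarrow> bool" where
  "is_cut X A \<longleftrightarrow> A \<subseteq> topspace X \<and> A = cut_closure X A"

definition directed_in :: "'a topology \<Rightarrow> 'a set \<Rightarrow> bool" where
  "directed_in X D \<longleftrightarrow> D \<subseteq> topspace X \<and> D \<noteq> {} \<and>
     (\<forall>x\<in>D. \<forall>y\<in>D. \<exists>z\<in>D. spec_le X x z \<and> spec_le X y z)"

definition irreducible_closedin :: "'a topology \<Rightarrow> 'a set \<Rightarrow> bool" where
  "irreducible_closedin X A \<longleftrightarrow> closedin X A \<and> A \<noteq> {} \<and>
     (\<forall>B C. closedin X B \<and> closedin X C \<and> A = B \<union> C \<longrightarrow> A = B \<or> A = C)"

definition cut_space :: "'a topology \<Rightarrow> bool" where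
  "cut_space X \<longleftrightarrow> (\<forall>D. directed_in X D \<longrightarrow> X closure_of D = cut_closure X D)"

definition weakly_sober_space :: "'a topology \<Rightarrow> bool" where
  "weakly_sober_space X \<longleftrightarrow> t0_space X \<and> (\<forall>A. irreducible_closedin X A \<longrightarrow> is_cut X A)"

definition quasisober_space :: "'a topology \<Rightarrow> bool" where
  "quasisober_space X \<longleftrightarrow> t0_space X \<and>
     (\<forall>A. irreducible_closedin X A \<longrightarrow> (\<exists>D. directed_in X D \<and> A = cut_closure X D))"

end

(* The naturals with the topology of upper sets have all three properties, because an unbounded
   set has no upper bound and is dense. In a power of this space, the x-axis is directed
   and closed, but it has no upper bound either, so its cut closure is the whole power. *)
theory Submission
  imports Defs
begin

text \<open>Closed sets are lower sets for the specialization preorder. If \<open>A\<close> were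
  neither \<open>B\<close> nor \<open>C\<close>, a common upper bound in \<open>A\<close> of a point
  outside \<open>B\<close> and a point outside \<open>C\<close> would lie in neither of
  them.\<close>

lemma irreducible_closedin_directed:
  assumes "closedin X A" "directed_in X A"
  shows "irreducible_closedin X A"
  unfolding irreducible_closedin_def
proof (intro conjI allI impI)
  show "A \<noteq> {}" using assms(2) by (simp add: directed_in_def)
  fix B C assume BC: "closedin X B \<and> closedin X C \<and> A = B \<union> C"
  have down: "x \<in> S" if "closedin X S" "z \<in> S" "spec_le X x z" for S x z
    using that closure_of_minimal[of "{z}" S X] by (auto simp: spec_le_def)
  show "A = B \<or> A = C"
  proof (rule ccontr)
    assume "\<not> (A = B \<or> A = C)"
    then obtain b c where "b \<in> A" "b \<notin> B" "c \<in> A" "c \<notin> C" using BC by blast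
    moreover from this obtain z where "z \<in> A" "spec_le X b z" "spec_le X c z"
      using assms(2) unfolding directed_in_def by blast
    ultimately show False using BC down by blast
  qed
qed (fact assms(1))

text \<open>Upper and lower bounds form a Galois connection: every upper bound of \<open>D\<close>
  still bounds the cut closure, so a second cut closure adds nothing.\<close>

lemma is_cut_cut_closure: "is_cut X (cut_closure X D)"
proof -
  have "upper_bounds_in X D \<subseteq> upper_bounds_in X (cut_closure X D)"
    unfolding cut_closure_def lower_bounds_in_def upper_bounds_in_def by blast
  then have "lower_bounds_in X (upper_bounds_in X (cut_closure X D))
      \<subseteq> lower_bounds_in X (upper_bounds_in X D)"
    unfolding lower_bounds_in_def by blast
  then have "cut_closure X (cut_closure X D) \<subseteq> cut_closure X D"
    by (simp only: cut_closure_def)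
  moreover have "cut_closure X D \<subseteq> topspace X"
    unfolding cut_closure_def lower_bounds_in_def by blast
  moreover have "A \<subseteq> cut_closure X A" if "A \<subseteq> topspace X" for A
    using that unfolding cut_closure_def lower_bounds_in_def upper_bounds_in_def by blast
  ultimately show ?thesis unfolding is_cut_def by blast
qed

text \<open>This serves twice: it makes the factors weakly sober, and by contraposition it reduces
  the failure of quasisobriety in the power to that of weak sobriety.\<close>

lemma quasisober_imp_weakly_sober: "quasisober_space X \<Longrightarrow> weakly_sober_space X"
  unfolding quasisober_space_def weakly_sober_space_def using is_cut_cut_closure by blast

definition upper_nat :: "nat topology" where
  "upper_nat = topology (\<lambda>U. \<forall>x\<in>U. \<forall>y\<ge>x. y \<in> U)"

lemma openin_upper_nat: "openin upper_nat U \<longleftrightarrow> (\<forall>x\<in>U. \<forall>y\<ge>x. y \<in> U)"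
proof -
  have "istopology (\<lambda>U. \<forall>x\<in>U. \<forall>y\<ge>x::nat. y \<in> U)"
    unfolding istopology_def by blast
  then show ?thesis by (simp add: upper_nat_def topology_inverse')
qed

lemma topspace_upper_nat [simp]: "topspace upper_nat = UNIV"
  using openin_subset[of upper_nat UNIV] by (auto simp: openin_upper_nat)

lemma closure_of_upper_nat: "upper_nat closure_of S = {x. \<exists>s\<in>S. x \<le> s}"
proof (intro equalityI subsetI)
  fix x assume "x \<in> upper_nat closure_of S"
  \<comment> \<open>\<open>{x..}\<close> is the least open neighbourhood of \<open>x\<close>, so it
    alone decides membership in a closure.\<close>
  moreover have "openin upper_nat {x..}" by (auto simp: openin_upper_nat)
  ultimately have "\<exists>y\<in>S. y \<in> {x..}" unfolding in_closure_of by blast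
  then show "x \<in> {x. \<exists>s\<in>S. x \<le> s}" by simp
next
  fix x assume "x \<in> {x. \<exists>s\<in>S. x \<le> s}"
  then obtain s where "s \<in> S" "x \<le> s" by blast
  then show "x \<in> upper_nat closure_of S" unfolding in_closure_of openin_upper_nat by auto
qed

lemma spec_le_upper_nat [simp]: "spec_le upper_nat x y \<longleftrightarrow> x \<le> y"
  by (simp add: spec_le_def closure_of_upper_nat)

text \<open>A point above all of \<open>S\<close> has a predecessor that still bounds
  \<open>S\<close>, so it is not below every upper bound. The empty set is different: its closure is
  empty, but its cut closure is \<open>{0}\<close>.\<close>

lemma cut_closure_upper_nat:
  assumes "S \<noteq> {}"
  shows "cut_closure upper_nat S = upper_nat closure_of S"
proof (intro equalityI subsetI)
  fix x assume x: "x \<in> cut_closure upper_nat S"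
  show "x \<in> upper_nat closure_of S"
  proof (rule ccontr)
    assume "x \<notin> upper_nat closure_of S"
    then have lt: "s < x" if "s \<in> S" for s
      using that by (force simp: closure_of_upper_nat)
    then have "x - 1 \<in> upper_bounds_in upper_nat S"
      by (force simp: upper_bounds_in_def)
    then have "x \<le> x - 1" using x by (auto simp: cut_closure_def lower_bounds_in_def)
    \<comment> \<open>With truncated subtraction \<open>x \<le> x - 1\<close> means
      \<open>x = 0\<close>, but some element of \<open>S\<close> is strictly below
      \<open>x\<close>.\<close>
    then show False using lt assms by force
  qed
next
  fix x assume "x \<in> upper_nat closure_of S"
  then show "x \<in> cut_closure upper_nat S"
    by (auto simp: closure_of_upper_nat cut_closure_def lower_bounds_in_def upper_bounds_in_def
        intro: order_trans)
qed

lemma cut_space_upper_nat: "cut_space upper_nat"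
  by (simp add: cut_space_def directed_in_def cut_closure_upper_nat)

lemma quasisober_upper_nat: "quasisober_space upper_nat"
  unfolding quasisober_space_def
proof (intro conjI allI impI)
  show "t0_space upper_nat"
    unfolding t0_space_def
  proof (intro ballI impI)
    fix x y :: nat assume "x \<noteq> y"
    then show "\<exists>U. openin upper_nat U \<and> (x \<notin> U \<longleftrightarrow> y \<in> U)"
      by (intro exI[of _ "{max x y..}"]) (auto simp: openin_upper_nat)
  qed
  fix A assume "irreducible_closedin upper_nat A"
  then have A: "closedin upper_nat A" "A \<noteq> {}" by (auto simp: irreducible_closedin_def)
  \<comment> \<open>In a chain every nonempty set is directed, so \<open>A\<close> can serve as its
    own \<open>D\<close>.\<close>
  have "\<exists>z\<in>A. x \<le> z \<and> y \<le> z" if "x \<in> A" "y \<in> A" for x y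
    using that by (intro bexI[of _ "max x y"]) (auto simp: max_def)
  then have "directed_in upper_nat A"
    using \<open>A \<noteq> {}\<close> by (simp add: directed_in_def)
  moreover have "A = cut_closure upper_nat A"
    using A by (simp add: cut_closure_upper_nat closure_of_closedin)
  ultimately show "\<exists>D. directed_in upper_nat D \<and> A = cut_closure upper_nat D" by blast
qed

text \<open>With all of \<open>nat\<close> as index set, the points are arbitrary functions and no
  extensionality condition remains.\<close>

definition upper_nat_power :: "(nat \<Rightarrow> nat) topology" where
  "upper_nat_power = product_topology (\<lambda>_. upper_nat) UNIV"

definition first_axis :: "(nat \<Rightarrow> nat) set" where
  "first_axis = {f. \<forall>i. i \<noteq> 0 \<longrightarrow> f i = 0}"

lemma topspace_upper_nat_power [simp]: "topspace upper_nat_power = UNIV"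
  by (simp add: upper_nat_power_def)

lemma spec_le_upper_nat_power [simp]: "spec_le upper_nat_power f g \<longleftrightarrow> f \<le> g"
proof -
  \<comment> \<open>A point is a box of singletons, and the closure of a box is the box of the
    closures; hence the order is pointwise.\<close>
  have "PiE UNIV (\<lambda>i. {g i}) = {g}" by (auto simp: PiE_UNIV_domain)
  then have "upper_nat_power closure_of {g} = PiE UNIV (\<lambda>i. upper_nat closure_of {g i})"
    using closure_of_product_topology[of "\<lambda>_. upper_nat" UNIV "\<lambda>i. {g i}"]
    by (simp only: upper_nat_power_def)
  then show ?thesis
    by (simp add: spec_le_def closure_of_upper_nat PiE_UNIV_domain Pi_iff le_fun_def)
qed

lemma directed_first_axis: "directed_in upper_nat_power first_axis"
  unfolding directed_in_def
proof (intro conjI ballI)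
  show "first_axis \<noteq> {}" by (auto simp: first_axis_def)
  fix f g assume "f \<in> first_axis" "g \<in> first_axis"
  then show "\<exists>h\<in>first_axis. spec_le upper_nat_power f h \<and> spec_le upper_nat_power g h"
    by (intro bexI[of _ "sup f g"]) (auto simp: first_axis_def)
qed simp

lemma closedin_first_axis: "closedin upper_nat_power first_axis"
proof -
  \<comment> \<open>The axis is a box whose sides are lower sets of the naturals, hence
    closed.\<close>
  have "first_axis = PiE UNIV (\<lambda>i. if i = 0 then UNIV else {0})"
    by (auto simp: first_axis_def PiE_UNIV_domain split: if_splits)
  moreover have "closedin upper_nat (if i = 0 then UNIV else {0})" for i :: nat
    by (simp add: closure_of_eq[symmetric] closure_of_upper_nat) blast
  then have "closedin upper_nat_power (PiE UNIV (\<lambda>i. if i = 0 then UNIV else {0}))"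
    unfolding upper_nat_power_def closedin_product_topology by blast
  ultimately show ?thesis by (simp only:)
qed

lemma cut_closure_first_axis: "cut_closure upper_nat_power first_axis = UNIV"
proof -
  have "\<not> (\<forall>f\<in>first_axis. f \<le> u)" for u
  proof
    assume "\<forall>f\<in>first_axis. f \<le> u"
    \<comment> \<open>This point of the axis exceeds the supposed bound \<open>u\<close> at
      coordinate 0.\<close>
    moreover have "(\<lambda>_. 0)(0 := Suc (u 0)) \<in> first_axis" by (simp add: first_axis_def)
    ultimately have "(\<lambda>_. 0)(0 := Suc (u 0)) \<le> u" by (rule bspec)
    from le_funD[OF this, of 0] show False by simp
  qed
  then have "upper_bounds_in upper_nat_power first_axis = {}"
    by (simp add: upper_bounds_in_def)
  \<comment> \<open>Every point is vacuously a lower bound of the empty set.\<close>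
  then show ?thesis by (simp add: cut_closure_def lower_bounds_in_def)
qed

lemma first_axis_not_UNIV: "first_axis \<noteq> UNIV"
proof -
  have "(\<lambda>_. 1) \<notin> first_axis" by (auto simp: first_axis_def)
  then show ?thesis by blast
qed

lemma not_cut_space_power: "\<not> cut_space upper_nat_power"
proof
  assume "cut_space upper_nat_power"
  then have "upper_nat_power closure_of first_axis = cut_closure upper_nat_power first_axis"
    using directed_first_axis by (simp add: cut_space_def)
  then show False
    using closure_of_closedin[OF closedin_first_axis] cut_closure_first_axis first_axis_not_UNIV
    by simp
qed

lemma not_weakly_sober_power: "\<not> weakly_sober_space upper_nat_power"
proof
  assume "weakly_sober_space upper_nat_power"
  then have "is_cut upper_nat_power first_axis"
    using irreducible_closedin_directed[OF closedin_first_axis directed_first_axis]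
    by (simp add: weakly_sober_space_def)
  then show False
    using cut_closure_first_axis first_axis_not_UNIV by (simp add: is_cut_def)
qed

theorem mainTheorem6:
  shows "(\<exists>(I :: nat set) (X :: nat \<Rightarrow> nat topology).
            (\<forall>i\<in>I. quasisober_space (X i)) \<and> \<not> quasisober_space (product_topology X I)) \<and>
         (\<exists>(I :: nat set) (X :: nat \<Rightarrow> nat topology).
            (\<forall>i\<in>I. cut_space (X i)) \<and> \<not> cut_space (product_topology X I)) \<and>
         (\<exists>(I :: nat set) (X :: nat \<Rightarrow> nat topology).
            (\<forall>i\<in>I. weakly_sober_space (X i)) \<and> \<not> weakly_sober_space (product_topology X I))"
proof (intro conjI exI)
  \<comment> \<open>One constant family witnesses all three claims.\<close>
  show "\<forall>i\<in>UNIV :: nat set. quasisober_space upper_nat"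
    "\<not> quasisober_space (product_topology (\<lambda>_. upper_nat) (UNIV :: nat set))"
    "\<forall>i\<in>UNIV :: nat set. cut_space upper_nat"
    "\<not> cut_space (product_topology (\<lambda>_. upper_nat) (UNIV :: nat set))"
    "\<forall>i\<in>UNIV :: nat set. weakly_sober_space upper_nat"
    "\<not> weakly_sober_space (product_topology (\<lambda>_. upper_nat) (UNIV :: nat set))"
    using quasisober_upper_nat cut_space_upper_nat not_cut_space_power not_weakly_sober_power
    by (auto simp: upper_nat_power_def dest: quasisober_imp_weakly_sober)
qed

end
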